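(* Let $n\ge 2$ be an integer. Then there exist diagonal matrices $A_1,\dots,A_{n+1}\in\mathrm{GL}(n,\mathbb{C})$ such that the abelian semigroup $G$ generated by $A_1,\dots,A_{n+1}$ is not hypercyclic and $J_G(e_k)=\mathbb{C}^n$ for every $k=1,\dots,n$, where $(e_1,\dots,e_n)$ is the canonical basis of $\mathbb{C}^n$.
   Context: $\mathbb{N}$ contains $0$. The abelian semigroup $G$ generated by pairwise commuting matrices $A_1,\dots,A_p$ is the set of products $A_1^{k_1}\cdots A_p^{k_p}$ with $k_j$ non-negative integers. The orbit of $v\in\mathbb{C}^n$ is $G(v)=\{Av: A\in G\}$. $G$ is hypercyclic if there exists $v\in\mathbb{C}^n$ with $G(v)$ dense in $\mathbb{C}^n$. Extended limit set: if $G$ is generated by $A_1,\dots,A_p$ and $x\in\mathbb{C}^n$, then $J_G(x)$ is the set of $y\in\mathbb{C}^n$ for which there exist a sequence $(x_m)_m\subset\mathbb{C}^n$ and sequences of non-negative integers $(k_m^{(j)})_m$, $j=1,\dots,p$, with $k_m^{(1)}+\dots+k_m^{(p)}\to+\infty$, such that $x_m\to x$ and $A_1^{k_m^{(1)}}\cdots A_p^{k_m^{(p)}}x_m\to y$. *)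

theory Defs
  imports "HOL-Analysis.Analysis"
begin

definition diagonal_matrix :: "'a::zero^'n^'n \<Rightarrow> bool" where
  "diagonal_matrix A \<longleftrightarrow> (\<forall>i j. i \<noteq> j \<longrightarrow> A $ i $ j = 0)"

(* The library's * and ^ on the type 'a^'n^'n act componentwise, so powers for
   the matrix product ** are defined here. *)
primrec matrix_power :: "'a::semiring_1^'n^'n \<Rightarrow> nat \<Rightarrow> 'a^'n^'n" where
  "matrix_power A 0 = mat 1"
| "matrix_power A (Suc m) = matrix_power A m ** A"

(* A_1^(k_1) ** ... ** A_p^(k_p); only the indices 1, ..., p of A and k are used. *)
primrec power_product :: "nat \<Rightarrow> (nat \<Rightarrow> 'a::semiring_1^'n^'n) \<Rightarrow> (nat \<Rightarrow> nat) \<Rightarrow> 'a^'n^'n" where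
  "power_product 0 A k = mat 1"
| "power_product (Suc p) A k = power_product p A k ** matrix_power (A (Suc p)) (k (Suc p))"

(* Intended for pairwise commuting A_1, ..., A_p; otherwise this set need not be
   closed under products. It contains the identity (all exponents zero). *)
definition generated_semigroup :: "nat \<Rightarrow> (nat \<Rightarrow> 'a::semiring_1^'n^'n) \<Rightarrow> ('a^'n^'n) set" where
  "generated_semigroup p A = {power_product p A k | k. True}"

definition orbit_of :: "(complex^'n^'n) set \<Rightarrow> complex^'n \<Rightarrow> (complex^'n) set" where
  "orbit_of G v = {A *v v | A. A \<in> G}"

definition hypercyclic :: "(complex^'n^'n) set \<Rightarrow> bool" where
  "hypercyclic G \<longleftrightarrow> (\<exists>v. closure (orbit_of G v) = UNIV)"

(* J_G(x) refers to the generators A_1, ..., A_p of G, hence they are the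
   arguments; k m j is the exponent of A_j at stage m. *)
definition extended_limit_set ::
  "nat \<Rightarrow> (nat \<Rightarrow> complex^'n^'n) \<Rightarrow> complex^'n \<Rightarrow> (complex^'n) set" where
  "extended_limit_set p A x =
    {y. \<exists>(X :: nat \<Rightarrow> complex^'n) (k :: nat \<Rightarrow> nat \<Rightarrow> nat).
          filterlim (\<lambda>m. \<Sum>j=1..p. k m j) at_top sequentially \<and>
          X \<longlonglongrightarrow> x \<and>
          (\<lambda>m. power_product p A (k m) *v X m) \<longlonglongrightarrow> y}"

end

theory Submission
  imports Defs "HOL-Computational_Algebra.Primes"
begin

text \<open>
Take complex numbers a, b with |a| < 1 < |b| such that the products a^k b^l with l arbitrarily large
are dense in the plane. Let A_j be the diagonal matrix with a in place j and 1 elsewhere (j = 1, ..., n),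
and let A_(n+1) be b times the identity. Using only A_r and A_(n+1), the r-th diagonal entry a^k b^l
approximates any number while all other entries b^l tend to infinity, so small perturbations of
e_r in the other coordinates reach any vector. On the other hand b cancels in the ratio of two coordinates
of a point in an orbit, whose modulus therefore only takes values in a discrete set times a constant.
\<close>

section \<open>Rational independence and approximation\<close>

text \<open>For nonzero \<open>m\<close> and \<open>n\<close> the multiplicity of \<open>p\<close>
  would be even on the left of the equation and odd on the right.\<close>

lemma prime_times_square_eq_imp_zero:
  fixes c m n p :: int
  assumes "prime p" "\<not> p dvd c" "c * m\<^sup>2 = p * n\<^sup>2"
  shows "n = 0"
proof (rule ccontr)
  assume n: "n \<noteq> 0"
  have p: "prime_elem p" "p \<noteq> 0"
    using assms(1) by auto
  have c: "c \<noteq> 0"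
    using assms(2) by auto
  have m: "m \<noteq> 0"
    using assms(3) n p by auto
  have "multiplicity p (c * m\<^sup>2) = 2 * multiplicity p m"
    using p c m assms(2)
    by (simp add: prime_elem_multiplicity_mult_distrib prime_elem_multiplicity_power_distrib
        not_dvd_imp_multiplicity_0)
  moreover have "multiplicity p (p * n\<^sup>2) = 1 + 2 * multiplicity p n"
    using p n
    by (simp add: prime_elem_multiplicity_mult_distrib prime_elem_multiplicity_power_distrib)
  ultimately have "2 * multiplicity p m = 1 + 2 * multiplicity p n"
    using assms(3) by simp
  then show False
    by presburger
qed

text \<open>Isolating the term with sqrt 3 and squaring leaves sqrt 2 with coefficient
  \<open>2 * p * q\<close>, which must vanish since sqrt 2 is irrational. Either case leaves an
  equation between a square and a multiple of a square, again excluded by parity of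
  multiplicities.\<close>

lemma int_combination_1_sqrt2_sqrt3_eq_0:
  fixes p q r :: int
  assumes "of_int p + of_int q * sqrt 2 + of_int r * sqrt 3 = (0::real)"
  shows "p = 0 \<and> q = 0 \<and> r = 0"
proof -
  have r3: "of_int r * sqrt 3 = - (of_int p + of_int q * sqrt 2)"
    using assms by linarith
  have "3 * (of_int r)\<^sup>2 = (of_int r * sqrt 3)\<^sup>2"
    by (simp add: power_mult_distrib)
  also have "\<dots> = (of_int p)\<^sup>2 + 2 * (of_int q)\<^sup>2 + 2 * of_int p * of_int q * sqrt 2"
    by (simp add: r3 power2_eq_square algebra_simps)
  finally have sq: "3 * (of_int r)\<^sup>2 = (of_int p)\<^sup>2 + 2 * (of_int q)\<^sup>2 + 2 * of_int p * of_int q * sqrt 2" .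
  then have "real_of_int (3 * r\<^sup>2 - p\<^sup>2 - 2 * q\<^sup>2) = of_int (2 * p * q) * sqrt 2"
    by simp
  then have "(real_of_int (3 * r\<^sup>2 - p\<^sup>2 - 2 * q\<^sup>2))\<^sup>2 = 2 * (of_int (2 * p * q))\<^sup>2"
    by (simp only: power_mult_distrib) simp
  then have "real_of_int (1 * (3 * r\<^sup>2 - p\<^sup>2 - 2 * q\<^sup>2)\<^sup>2) = real_of_int (2 * (2 * p * q)\<^sup>2)"
    by simp
  then have "1 * (3 * r\<^sup>2 - p\<^sup>2 - 2 * q\<^sup>2)\<^sup>2 = 2 * (2 * p * q)\<^sup>2"
    by (simp only: of_int_eq_iff)
  then have "2 * p * q = 0"
    by (intro prime_times_square_eq_imp_zero [of 2 1]) auto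
  then have "p = 0 \<or> q = 0"
    by simp
  moreover have "real_of_int (3 * r\<^sup>2) = real_of_int (p\<^sup>2 + 2 * q\<^sup>2)"
    using sq \<open>p = 0 \<or> q = 0\<close> by auto
  then have eq: "3 * r\<^sup>2 = p\<^sup>2 + 2 * q\<^sup>2"
    by (simp only: of_int_eq_iff)
  ultimately show ?thesis
  proof (elim disjE)
    assume "p = 0"
    then have "q = 0"
      using eq by (intro prime_times_square_eq_imp_zero [of 2 3 r]) auto
    with \<open>p = 0\<close> eq show ?thesis by simp
  next
    assume "q = 0"
    then have "r = 0"
      using eq by (intro prime_times_square_eq_imp_zero [of 3 1 p]) auto
    with \<open>q = 0\<close> eq show ?thesis by simp
  qed
qed

text \<open>The multiplier becomes an exponent, so it must be natural and arbitrarily large, while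
  Kronecker's theorem gives an integer of unknown sign. Dirichlet's theorem supplies a positive
  multiple \<open>q * S\<close> that moves all \<open>of_int k * \<theta> i\<close> by almost an
  integer.\<close>

lemma Kronecker_simult_large:
  fixes \<alpha> \<theta> :: "nat \<Rightarrow> real" and n M :: nat
  assumes indp: "module.independent (\<lambda>r x. of_int r * x) (\<theta> ` {..n})"
    and "inj_on \<theta> {..n}" "\<theta> n = 1" "\<epsilon> > 0"
  obtains k m where "k \<ge> M" "\<And>i. i < n \<Longrightarrow> \<bar>of_nat k * \<theta> i - of_int (m i) - \<alpha> i\<bar> < \<epsilon>"
proof -
  obtain k m where km: "\<And>i. i < n \<Longrightarrow> \<bar>of_int k * \<theta> i - of_int (m i) - \<alpha> i\<bar> < \<epsilon> / 2"
    using Kronecker_thm_2 [OF assms(1-3), of "\<epsilon> / 2"] assms(4) by auto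
  obtain N :: nat where N: "N > 0" "1 / N < \<epsilon> / 2"
    using assms(4) by (metis gr_zeroI half_gt_zero inverse_eq_divide real_arch_inverse)
  \<comment> \<open>A large almost-period, added to the possibly negative k.\<close>
  define S where "S = int M + \<bar>k\<bar>"
  obtain q p where q: "0 < q"
    and qp: "\<And>i. i < n \<Longrightarrow> \<bar>of_int q * (of_int S * \<theta> i) - of_int (p i)\<bar> < 1 / N"
    using Dirichlet_approx_simult [OF N(1), where n = n and \<theta> = "\<lambda>i. of_int S * \<theta> i"] by metis
  have "S \<le> q * S"
    using q mult_right_mono [of 1 q S] by (simp add: S_def)
  then have ge: "k + q * S \<ge> int M"
    by (simp add: S_def)
  show thesis
  proof
    show "M \<le> nat (k + q * S)"
      using ge by simp
    fix i assume "i < n"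
    have "of_nat (nat (k + q * S)) = real_of_int k + of_int q * of_int S"
      using ge by simp
    then have "real (nat (k + q * S)) * \<theta> i = of_int k * \<theta> i + of_int q * (of_int S * \<theta> i)"
      by (simp only: distrib_right mult.assoc)
    then show "\<bar>of_nat (nat (k + q * S)) * \<theta> i - of_int (m i + p i) - \<alpha> i\<bar> < \<epsilon>"
      using km [OF \<open>i < n\<close>] qp [OF \<open>i < n\<close>] N(2) unfolding of_int_add by linarith
  qed
qed

lemma sqrt2_sqrt3_approx:
  fixes x y :: real
  assumes "\<epsilon> > 0"
  obtains k :: nat and m m' :: int
  where "k \<ge> M" "\<bar>k * sqrt 2 - m - x\<bar> < \<epsilon>" "\<bar>k * sqrt 3 - m' - y\<bar> < \<epsilon>"
proof -
  interpret Modules.module "\<lambda>r. (*) (real_of_int r)"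
    by (simp add: Modules.module.intro distrib_left mult.commute)
  define \<theta> :: "nat \<Rightarrow> real" where "\<theta> = (\<lambda>i. if i = 0 then sqrt 2 else if i = 1 then sqrt 3 else 1)"
  have neq: "sqrt 2 \<noteq> 1" "sqrt 3 \<noteq> 1" "sqrt 2 \<noteq> sqrt 3"
    by auto
  have sum3: "(\<Sum>v\<in>{sqrt 2, sqrt 3, 1}. f v) = f 1 + f (sqrt 2) + f (sqrt 3)" for f :: "real \<Rightarrow> real"
    using neq by simp
  have img: "\<theta> ` {..2} = {sqrt 2, sqrt 3, 1}"
    by (auto simp: \<theta>_def image_iff intro: bexI [of _ 0] bexI [of _ 1] bexI [of _ 2])
  have "u v = 0" if "finite T" "T \<subseteq> {sqrt 2, sqrt 3, 1}" "(\<Sum>v\<in>T. of_int (u v) * v) = 0" "v \<in> T"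
    for T v and u :: "real \<Rightarrow> int"
  proof -
    \<comment> \<open>Extending the coefficients by zero turns a relation on the subset
      \<open>T\<close> into one between all three numbers.\<close>
    define u' where "u' = (\<lambda>w. if w \<in> T then u w else 0)"
    have "(\<Sum>w\<in>{sqrt 2, sqrt 3, 1}. of_int (u' w) * w) = (\<Sum>w\<in>T. of_int (u w) * w)"
      using that(2) by (intro sum.mono_neutral_cong_right) (auto simp: u'_def)
    then have "of_int (u' 1) + of_int (u' (sqrt 2)) * sqrt 2 + of_int (u' (sqrt 3)) * sqrt 3 = 0"
      using that(3) sum3 [of "\<lambda>w. of_int (u' w) * w"] by simp
    then have "u' v = 0"
      using int_combination_1_sqrt2_sqrt3_eq_0 that(2,4) by blast
    then show ?thesis
      using that(4) by (simp add: u'_def)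
  qed
  then have indep: "independent (\<theta> ` {..2})"
    unfolding img independent_explicit_module by blast
  have inj: "inj_on \<theta> {..2}"
    using neq by (auto simp: inj_on_def \<theta>_def)
  obtain k m where "k \<ge> M" "\<And>i. i < 2 \<Longrightarrow> \<bar>of_nat k * \<theta> i - of_int (m i) - (if i = 0 then x else y)\<bar> < \<epsilon>"
    using Kronecker_simult_large [OF indep inj _ assms, of M "\<lambda>i. if i = 0 then x else y"]
    by (auto simp: \<theta>_def)
  from this(1) this(2) [of 0] this(2) [of 1] show thesis
    by (intro that) (auto simp: \<theta>_def)
qed

section \<open>A dense two-generator semigroup of complex numbers\<close>

text \<open>
With m = l sqrt 2 - \<rho> - e for a small e, the product gen_a ^ m * gen_b ^ l has modulus exp (\<rho> + e), and the argument
2 pi m sqrt 3 / sqrt 2 differs from 2 pi (l sqrt 3 - \<rho> sqrt 3 / sqrt 2) by a small amount. So modulus and argument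
are controlled by l sqrt 2 and l sqrt 3 modulo 1, to which Kronecker's theorem applies.
\<close>
definition gen_a :: complex where
  "gen_a = exp (Complex (- 1) (2 * pi * (sqrt 3 / sqrt 2)))"

definition gen_b :: complex where
  "gen_b = exp (of_real (sqrt 2))"

lemma norm_gen_a: "norm gen_a = exp (- 1)"
  by (simp add: gen_a_def)

lemma norm_gen_b: "norm gen_b > 1"
  by (simp add: gen_b_def)

lemma gen_powers_approx_nonzero:
  assumes "z \<noteq> 0" "\<epsilon> > 0"
  shows "\<exists>k l. l \<ge> L \<and> norm (gen_a ^ k * gen_b ^ l - z) < \<epsilon>"
proof -
  define \<alpha> where "\<alpha> = sqrt 3 / sqrt 2"
  have \<alpha>2: "\<alpha> * sqrt 2 = sqrt 3"
    by (simp add: \<alpha>_def)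
  have \<alpha>0: "\<alpha> > 0"
    by (simp add: \<alpha>_def)
  define \<rho> \<tau> where "\<rho> = Re (Ln z)" and "\<tau> = Im (Ln z)"
  have z: "exp (Complex \<rho> \<tau>) = z"
    unfolding \<rho>_def \<tau>_def complex_surj using assms(1) by (rule exp_Ln)
  \<comment> \<open>The product will equal \<open>z * exp w\<close> with small \<open>w\<close>;
    continuity turns this multiplicative error into an additive one.\<close>
  have "isCont (\<lambda>w. z * exp w) 0"
    by (intro continuous_intros)
  then obtain d where d: "d > 0" "\<And>w. norm w < d \<Longrightarrow> norm (z * exp w - z) < \<epsilon>"
    using assms(2) unfolding continuous_at_eps_delta by (auto simp: dist_norm)
  \<comment> \<open>\<open>\<eta> * C\<close> bounds the norm of \<open>w\<close> once both
    approximation errors \<open>e\<close> and \<open>e'\<close> are below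
    \<open>\<eta>\<close>.\<close>
  define C where "C = 1 + 2 * pi * (1 + \<alpha>)"
  have C: "C \<ge> 1"
    using \<alpha>0 by (simp add: C_def)
  define \<eta> where "\<eta> = min 1 (d / C)"
  have \<eta>: "\<eta> > 0" "\<eta> \<le> 1" "\<eta> * C \<le> d"
    using d(1) C by (auto simp: \<eta>_def min_def field_simps)
  \<comment> \<open>The second summand, together with \<open>\<eta> \<le> 1\<close>, makes
    \<open>m\<close> nonnegative, so that it can serve as the exponent of
    \<open>gen_a\<close>.\<close>
  define M where "M = L + nat \<lceil>\<bar>\<rho>\<bar> + 1\<rceil>"
  \<comment> \<open>Up to a small error \<open>\<alpha> * m\<close> is
    \<open>l * sqrt 3 - \<alpha> * \<rho>\<close>, so this target for \<open>l * sqrt 3\<close>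
    modulo 1 gives the product the argument \<open>\<tau>\<close> modulo 2 pi.\<close>
  obtain l m m' where l: "l \<ge> M"
    and m: "\<bar>real l * sqrt 2 - of_int m - \<rho>\<bar> < \<eta>"
    and m': "\<bar>real l * sqrt 3 - of_int m' - (\<alpha> * \<rho> + \<tau> / (2 * pi))\<bar> < \<eta>"
    by (rule sqrt2_sqrt3_approx [OF \<eta>(1)])
  define e e' where "e = real l * sqrt 2 - of_int m - \<rho>"
    and "e' = real l * sqrt 3 - of_int m' - (\<alpha> * \<rho> + \<tau> / (2 * pi))"
  have "real l \<ge> \<bar>\<rho>\<bar> + 1"
    using l unfolding M_def by linarith
  moreover have "real l * sqrt 2 \<ge> real l"
    using mult_left_mono [of 1 "sqrt 2" "real l"] by simp
  ultimately have "real_of_int m > - 1"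
    using m \<eta>(2) by linarith
  then have m0: "m \<ge> 0"
    by linarith
  define k where "k = nat m"
  have k: "real k = of_int m"
    using m0 by (simp add: k_def)
  have e: "of_int m = real l * sqrt 2 - \<rho> - e"
    by (simp add: e_def)
  have "\<alpha> * of_int m = real l * sqrt 3 - \<alpha> * \<rho> - \<alpha> * e"
    unfolding e by (simp add: right_diff_distrib \<alpha>2 [symmetric])
  also have "\<dots> = of_int m' + \<tau> / (2 * pi) + (e' - \<alpha> * e)"
    by (simp add: e'_def)
  finally have phase: "2 * pi * (\<alpha> * of_int m) = \<tau> + 2 * pi * (e' - \<alpha> * e) + 2 * of_int m' * pi"
    by (simp add: field_simps)
  define w where "w = Complex e (2 * pi * (e' - \<alpha> * e))"
  have "gen_a ^ k * gen_b ^ l =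
      exp (of_nat k * Complex (- 1) (2 * pi * \<alpha>) + of_nat l * of_real (sqrt 2))"
    by (simp add: gen_a_def gen_b_def \<alpha>_def exp_of_nat_mult exp_add)
  also have "of_nat k * Complex (- 1) (2 * pi * \<alpha>) + of_nat l * of_real (sqrt 2) =
      Complex \<rho> \<tau> + w + of_int (2 * m') * pi * \<i>"
    using phase by (intro complex_eqI) (simp_all add: w_def k e_def algebra_simps)
  also have "exp \<dots> = z * exp w"
    using exp_integer_2pi [of "of_int m'"] by (simp only: exp_add z) simp
  finally have eq: "gen_a ^ k * gen_b ^ l = z * exp w" .
  have "norm w \<le> \<bar>e\<bar> + \<bar>2 * pi * (e' - \<alpha> * e)\<bar>"
    using cmod_le [of w] by (simp add: w_def)
  also have "\<dots> \<le> \<bar>e\<bar> + 2 * pi * (\<bar>e'\<bar> + \<alpha> * \<bar>e\<bar>)"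
    using \<alpha>0 abs_triangle_ineq4 [of e' "\<alpha> * e"] by (simp add: abs_mult)
  also have "\<dots> < \<eta> + 2 * pi * (\<eta> + \<alpha> * \<eta>)"
    using m m' \<alpha>0 unfolding e_def [symmetric] e'_def [symmetric]
    by (intro add_strict_mono mult_strict_left_mono) auto
  also have "\<dots> = \<eta> * C"
    by (simp add: C_def algebra_simps)
  finally have "norm w < d"
    using \<eta>(3) by linarith
  then have "norm (gen_a ^ k * gen_b ^ l - z) < \<epsilon>"
    using d(2) eq by simp
  moreover have "l \<ge> L"
    using l by (simp add: M_def)
  ultimately show ?thesis by blast
qed

text \<open>Zero has no logarithm; it is approximated through the nonzero number
  \<open>\<epsilon> / 2\<close>.\<close>

lemma gen_powers_approx:
  assumes "\<epsilon> > 0"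
  shows "\<exists>k l. l \<ge> L \<and> norm (gen_a ^ k * gen_b ^ l - z) < \<epsilon>"
proof (cases "z = 0")
  case True
  obtain k l where "l \<ge> L" "norm (gen_a ^ k * gen_b ^ l - of_real (\<epsilon> / 2)) < \<epsilon> / 2"
    using gen_powers_approx_nonzero [of "of_real (\<epsilon> / 2)" "\<epsilon> / 2" L] assms by auto
  moreover from this(2) have "norm (gen_a ^ k * gen_b ^ l) < \<epsilon>"
    using norm_triangle_sub [of "gen_a ^ k * gen_b ^ l" "of_real (\<epsilon> / 2)"] assms
    by (simp add: norm_of_real del: of_real_divide)
  ultimately show ?thesis
    using True by auto
qed (use gen_powers_approx_nonzero assms in blast)

text \<open>The bound on \<open>l m\<close> forces the powers \<open>gen_b ^ l m\<close> to diverge,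
  which later makes the perturbations vanish.\<close>

lemma gen_powers_tendsto:
  obtains k l :: "nat \<Rightarrow> nat"
  where "\<And>m. l m \<ge> m" "(\<lambda>m. gen_a ^ k m * gen_b ^ l m) \<longlonglongrightarrow> z"
proof -
  have "\<exists>k l. l \<ge> m \<and> norm (gen_a ^ k * gen_b ^ l - z) < inverse (Suc m)" for m
    by (intro gen_powers_approx) simp
  then obtain k l where kl: "\<And>m. l m \<ge> m"
      "\<And>m. norm (gen_a ^ k m * gen_b ^ l m - z) < inverse (Suc m)"
    by metis
  have "(\<lambda>m. gen_a ^ k m * gen_b ^ l m - z) \<longlonglongrightarrow> 0"
    using kl(2) by (intro Lim_null_comparison [OF _ LIMSEQ_inverse_real_of_nat]) (simp add: less_imp_le)
  then show thesis
    using that [of l k] kl(1) LIM_zero_iff by blast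
qed

section \<open>Diagonal matrices\<close>

definition diag :: "('n \<Rightarrow> 'a::zero) \<Rightarrow> 'a^'n^'n" where
  "diag d = (\<chi> i j. if i = j then d i else 0)"

lemma diagonal_matrix_diag: "diagonal_matrix (diag d)"
  by (simp add: diagonal_matrix_def diag_def)

lemma diag_one: "diag (\<lambda>_. 1) = mat 1"
  by (simp add: diag_def mat_def)

lemma sum_diag_entry_mult:
  fixes f :: "'n::finite \<Rightarrow> 'a::semiring_1"
  shows "(\<Sum>j\<in>UNIV. (if i = j then c else 0) * f j) = c * f i"
proof -
  have "(\<Sum>j\<in>UNIV. (if i = j then c else 0) * f j) = (\<Sum>j\<in>UNIV. if i = j then c * f j else 0)"
    by (intro sum.cong) auto
  then show ?thesis by simp
qed

lemma diag_mult:
  fixes c d :: "'n::finite \<Rightarrow> 'a::semiring_1"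
  shows "diag c ** diag d = diag (\<lambda>i. c i * d i)"
  by (simp add: diag_def matrix_matrix_mult_def vec_eq_iff sum_diag_entry_mult)

lemma diag_mult_vector:
  fixes d :: "'n::finite \<Rightarrow> 'a::semiring_1"
  shows "(diag d *v x) $ i = d i * x $ i"
  by (simp add: diag_def matrix_vector_mult_def sum_diag_entry_mult)

lemma invertible_diag:
  fixes d :: "'n::finite \<Rightarrow> 'a::field"
  assumes "\<And>i. d i \<noteq> 0"
  shows "invertible (diag d)"
  unfolding invertible_def
  using assms by (intro exI [of _ "diag (\<lambda>i. inverse (d i))"]) (simp add: diag_mult diag_one)

lemma matrix_power_diag:
  fixes d :: "'n::finite \<Rightarrow> 'a::comm_semiring_1"
  shows "matrix_power (diag d) m = diag (\<lambda>i. d i ^ m)"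
  by (induction m) (simp_all add: diag_one diag_mult mult.commute)

lemma power_product_diag:
  fixes d :: "nat \<Rightarrow> 'n::finite \<Rightarrow> 'a::comm_semiring_1"
  shows "power_product p (\<lambda>j. diag (d j)) k = diag (\<lambda>i. \<Prod>j=1..p. d j i ^ k j)"
  by (induction p) (simp_all add: diag_one diag_mult matrix_power_diag mult.commute)

section \<open>The generators, their extended limit sets and their orbits\<close>

definition gen_entry :: "(nat \<Rightarrow> 'n::finite) \<Rightarrow> nat \<Rightarrow> 'n \<Rightarrow> complex" where
  "gen_entry h j i = (if j \<le> CARD('n) then if i = h j then gen_a else 1 else gen_b)"

text \<open>The bijection \<open>h\<close> numbers the coordinates, as generators are indexed by
  naturals. At coordinate \<open>h j\<close> only the \<open>j\<close>-th and the last generator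
  have an entry other than 1.\<close>

lemma power_product_gen:
  fixes h :: "nat \<Rightarrow> 'n::finite"
  assumes h: "bij_betw h {1..CARD('n)} UNIV" and j: "j \<in> {1..CARD('n)}"
  shows "(power_product (CARD('n) + 1) (\<lambda>j. diag (gen_entry h j)) k *v x) $ h j =
    gen_a ^ k j * gen_b ^ k (CARD('n) + 1) * x $ h j"
proof -
  have "gen_entry h j' (h j) ^ k j' = (if j' = j then gen_a ^ k j else 1)" if "j' \<in> {1..CARD('n)}" for j'
    using inj_on_eq_iff [OF bij_betw_imp_inj_on [OF h] j that] that by (auto simp: gen_entry_def)
  then have "(\<Prod>j'=1..CARD('n). gen_entry h j' (h j) ^ k j') =
      (\<Prod>j'=1..CARD('n). if j' = j then gen_a ^ k j else 1)"
    by (rule prod.cong [OF refl])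
  also have "\<dots> = gen_a ^ k j"
    using j by (simp only: prod.delta finite_atLeastAtMost if_True)
  finally have "(\<Prod>j'=1..CARD('n) + 1. gen_entry h j' (h j) ^ k j') =
      gen_a ^ k j * gen_entry h (CARD('n) + 1) (h j) ^ k (CARD('n) + 1)"
    by simp
  then show ?thesis
    unfolding power_product_diag diag_mult_vector by (simp only: gen_entry_def) simp
qed

lemma extended_limit_set_gen:
  fixes h :: "nat \<Rightarrow> 'n::finite" and r :: 'n
  assumes h: "bij_betw h {1..CARD('n)} UNIV"
  shows "extended_limit_set (CARD('n) + 1) (\<lambda>j. diag (gen_entry h j)) (axis r 1) = UNIV"
    (is "extended_limit_set ?p ?A _ = _")
proof -
  have "y \<in> extended_limit_set ?p ?A (axis r 1)" for y
  proof -
    obtain K l where l: "\<And>m. l m \<ge> m" and Kl: "(\<lambda>m. gen_a ^ K m * gen_b ^ l m) \<longlonglongrightarrow> y $ r"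
      using gen_powers_tendsto [of "y $ r"] by blast
    obtain s where s: "s \<in> {1..CARD('n)}" "h s = r"
      using h by (metis UNIV_I bij_betw_iff_bijections)
    define k where "k = (\<lambda>m j. if j = ?p then l m else if j = s then K m else 0)"
    \<comment> \<open>Off \<open>r\<close> the exponent of \<open>gen_a\<close> is zero, so dividing
      by \<open>gen_b ^ l m\<close> makes the image exactly \<open>y $ i\<close>; at
      \<open>r\<close> the image is the approximating product itself.\<close>
    define X :: "nat \<Rightarrow> complex^'n"
      where "X = (\<lambda>m. \<chi> i. if i = r then 1 else y $ i / gen_b ^ l m)"
    have b0: "gen_b \<noteq> 0"
      using norm_gen_b by auto
    have l_top: "filterlim l at_top sequentially"
      using l by (intro filterlim_at_top_mono [OF filterlim_ident]) auto
    have "l m \<le> (\<Sum>j=1..?p. k m j)" for m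
      using member_le_sum [of ?p "{1..?p}" "k m"] by (simp add: k_def)
    then have "filterlim (\<lambda>m. \<Sum>j=1..?p. k m j) at_top sequentially"
      by (intro filterlim_at_top_mono [OF l_top] always_eventually) blast
    moreover have "X \<longlonglongrightarrow> axis r 1"
    proof (rule vec_tendstoI)
      fix i
      have "(\<lambda>m. inverse gen_b ^ l m) \<longlonglongrightarrow> 0"
        using norm_gen_b
        by (intro filterlim_compose [OF LIMSEQ_power_zero l_top])
          (simp add: norm_inverse inverse_less_1_iff)
      then have "(\<lambda>m. y $ i * inverse gen_b ^ l m) \<longlonglongrightarrow> 0"
        by (rule tendsto_mult_right_zero)
      then show "(\<lambda>m. X m $ i) \<longlonglongrightarrow> axis r 1 $ i"
        by (cases "i = r") (simp_all add: X_def axis_def divide_inverse power_inverse)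
    qed
    moreover have "(\<lambda>m. power_product ?p ?A (k m) *v X m) \<longlonglongrightarrow> y"
    proof (rule vec_tendstoI)
      fix i
      obtain j where j: "j \<in> {1..CARD('n)}" "h j = i"
        using h by (metis UNIV_I bij_betw_iff_bijections)
      have eq: "(power_product ?p ?A (k m) *v X m) $ i = gen_a ^ k m j * gen_b ^ l m * X m $ i" for m
        unfolding power_product_gen [OF h j(1), unfolded j(2)] by (simp add: k_def)
      show "(\<lambda>m. (power_product ?p ?A (k m) *v X m) $ i) \<longlonglongrightarrow> y $ i"
      proof (cases "i = r")
        case True
        then have "j = s"
          using j s bij_betw_imp_inj_on [OF h] by (auto dest: inj_onD)
        then have "k m j = K m" for m
          using s by (simp add: k_def)
        then show ?thesis
          unfolding eq using Kl True by (simp add: X_def)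
      next
        case False
        then have "k m j = 0" for m
          using j s by (auto simp: k_def)
        then show ?thesis
          unfolding eq using False b0 by (simp add: X_def)
      qed
    qed
    ultimately show ?thesis
      unfolding extended_limit_set_def by blast
  qed
  then show ?thesis by blast
qed

lemma not_hypercyclic_gen:
  fixes h :: "nat \<Rightarrow> 'n::finite"
  assumes h: "bij_betw h {1..CARD('n)} UNIV" and n: "CARD('n) \<ge> 2"
  shows "\<not> hypercyclic (generated_semigroup (CARD('n) + 1) (\<lambda>j. diag (gen_entry h j)))"
    (is "\<not> hypercyclic ?G")
proof
  assume "hypercyclic ?G"
  then obtain v where v: "closure (orbit_of ?G v) = UNIV"
    by (auto simp: hypercyclic_def)
  define p q where "p = h 1" and "q = h 2"
  have "p \<noteq> q"
    using n inj_on_eq_iff [OF bij_betw_imp_inj_on [OF h], of 1 2] by (simp add: p_def q_def)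
  have orbit: "\<exists>k k' l. x $ p = gen_a ^ k * gen_b ^ l * v $ p \<and> x $ q = gen_a ^ k' * gen_b ^ l * v $ q"
    if in_orbit: "x \<in> orbit_of ?G v" for x
  proof -
    obtain k where x: "x = power_product (CARD('n) + 1) (\<lambda>j. diag (gen_entry h j)) k *v v"
      using in_orbit unfolding orbit_of_def generated_semigroup_def by blast
    have "x $ h j = gen_a ^ k j * gen_b ^ k (CARD('n) + 1) * v $ h j" if "j = 1 \<or> j = 2" for j
    proof -
      have "j \<in> {1..CARD('n)}"
        using that n by auto
      then show ?thesis
        unfolding x by (rule power_product_gen [OF h])
    qed
    from this [of 1] this [of 2] show ?thesis
      unfolding p_def q_def by blast
  qed
  have closed_UNIV: "S = UNIV" if "closed S" "orbit_of ?G v \<subseteq> S" for S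
    using closure_minimal [OF that(2,1)] v by auto
  \<comment> \<open>Otherwise the orbit would lie in a proper closed hyperplane.\<close>
  have nonzero: "v $ i \<noteq> 0" if "i = p \<or> i = q" for i
  proof
    assume "v $ i = 0"
    then have "orbit_of ?G v \<subseteq> {x. x $ i = 0}"
      using that orbit by (metis (mono_tags, lifting) mem_Collect_eq mult_zero_right subsetI)
    moreover have "closed {x :: complex^'n. x $ i = 0}"
      by (intro closed_Collect_eq continuous_intros)
    ultimately have "{x :: complex^'n. x $ i = 0} = UNIV"
      using closed_UNIV by blast
    then have "axis i (1::complex) \<in> {x. x $ i = 0}"
      by (simp only: UNIV_I)
    then show False by simp
  qed
  \<comment> \<open>The ratio of coordinates \<open>p\<close> and \<open>q\<close>, relative to that
    of \<open>v\<close>, is cross-multiplied so that both sides are continuous everywhere, even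
    where a coordinate vanishes.\<close>
  define f g where "f = (\<lambda>x :: complex^'n. norm (x $ p) * norm (v $ q))"
    and "g = (\<lambda>x :: complex^'n. norm (x $ q) * norm (v $ p))"
  \<comment> \<open>On the orbit the ratio of f to g is an integral power of e, so it avoids the interval (1, e).\<close>
  define S where "S = {x. f x \<le> g x} \<union> {x. exp 1 * g x \<le> f x}"
  have "closed S"
    unfolding S_def f_def g_def by (intro closed_Un closed_Collect_le continuous_intros)
  moreover have "orbit_of ?G v \<subseteq> S"
  proof
    fix x assume "x \<in> orbit_of ?G v"
    then obtain k k' l where x: "x $ p = gen_a ^ k * gen_b ^ l * v $ p"
        "x $ q = gen_a ^ k' * gen_b ^ l * v $ q"
      using orbit by blast
    define c where "c = norm gen_b ^ l * norm (v $ p) * norm (v $ q)"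
    have c: "c \<ge> 0"
      by (simp add: c_def)
    have a: "norm gen_a ^ j = exp (- real j)" for j
      using exp_of_nat_mult [of j "- 1 :: real"] by (simp add: norm_gen_a)
    have f: "f x = exp (- real k) * c" and g: "g x = exp (- real k') * c"
      by (simp_all add: f_def g_def x c_def norm_mult norm_power a)
    show "x \<in> S"
    proof (cases "k' \<le> k")
      case True
      then show ?thesis
        using c by (auto simp: S_def f g intro!: mult_right_mono)
    next
      case False
      \<comment> \<open>Here \<open>k < k'\<close>, and integrality gives
        \<open>k + 1 \<le> k'\<close>: this is the gap by a factor e.\<close>
      then have "exp 1 * exp (- real k') \<le> exp (- real k)"
        by (simp add: exp_add [symmetric])
      from mult_right_mono [OF this c] show ?thesis
        by (simp add: S_def f g mult.assoc)
    qed
  qed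
  ultimately have "S = UNIV"
    by (rule closed_UNIV)
  \<comment> \<open>Doubling one coordinate of \<open>v\<close> gives the ratio 2, which lies
    strictly between 1 and e.\<close>
  define x :: "complex^'n" where "x = (\<chi> i. if i = p then 2 * v $ p else v $ i)"
  have "f x = 2 * g x" "g x > 0"
    using \<open>p \<noteq> q\<close> nonzero by (auto simp: f_def g_def x_def norm_mult)
  moreover have "exp 1 > (2::real)"
    using exp_lower_Taylor_quadratic [of 1] by simp
  ultimately have "x \<notin> S"
    by (auto simp: S_def)
  with \<open>S = UNIV\<close> show False by blast
qed

theorem theorem1p5:
  assumes "CARD('n::finite) \<ge> 2"
  shows "\<exists>A :: nat \<Rightarrow> complex^'n^'n.
           (\<forall>j\<in>{1..CARD('n) + 1}. diagonal_matrix (A j) \<and> invertible (A j)) \<and>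
           \<not> hypercyclic (generated_semigroup (CARD('n) + 1) A) \<and>
           (\<forall>k::'n. extended_limit_set (CARD('n) + 1) A (axis k 1) = UNIV)"
proof -
  obtain h :: "nat \<Rightarrow> 'n" where h: "bij_betw h {1..CARD('n)} UNIV"
    using ex_bij_betw_nat_finite_1 [OF finite [of "UNIV :: 'n set"]] by blast
  have "gen_entry h j i \<noteq> 0" for j i
    using norm_gen_a norm_gen_b by (auto simp: gen_entry_def)
  then show ?thesis
    using not_hypercyclic_gen [OF h assms] extended_limit_set_gen [OF h]
    by (intro exI [of _ "\<lambda>j. diag (gen_entry h j)"])
      (simp add: diagonal_matrix_diag invertible_diag)
qed

end
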